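(* The algebra $\mathcal{T}:=\mathbb{C}[g_1,g_2,g_3,\ldots]$ is closed under the action of $D:=q\frac{\partial}{\partial q}$. Moreover, for $k\in\mathbb{N}$ we have $$D(g_k)=\frac{g_{k+2}}2-\frac12\sum_{d=0}^{k}\binom{k}{d}g_{d+1}\,g_{k-d+1},\qquad D\left(\mathrm{Log}(T_0)\right)=-\frac{g_2}2+\frac{g_1^2}2 .$$
   Context: $\mathbb{N}=\{1,2,\dots\}$, $\tau$ lies in the complex upper half-plane $\mathbb{H}$, $q:=e^{2\pi i\tau}$, $\zeta:=e^{2\pi i z}$, with $q^{r}:=e^{2\pi i r\tau}$ and $\zeta^{r}:=e^{2\pi i r z}$ for $r\in\mathbb{Q}$; thus $D=\frac1{2\pi i}\frac{d}{d\tau}$ on functions of $\tau$. Partial theta function: $T(z;\tau):=2i\sum_{n\ge0}(-1)^n\zeta^{n+\frac12}q^{\frac12(n+\frac12)^2}$ and $T_0(\tau):=T(0;\tau)$. The partial Eisenstein series $g_k$, $k\in\mathbb{N}$, are defined by the expansion around $z=0$ $$T(z;\tau)=T_0(\tau)\exp\left(-\sum_{k\ge1}g_k(\tau)\frac{(2\pi i z)^k}{k!}\right).$$ They are holomorphic where $T_0\neq0$, i.e. meromorphic functions on $\mathbb{H}$, and $\mathcal{T}$ is the $\mathbb{C}$-algebra of functions they generate. $D(\mathrm{Log}(T_0))$ denotes the logarithmic derivative $D(T_0)/T_0$. *)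

theory Defs
  imports "HOL-Complex_Analysis.Complex_Analysis"
begin

definition partial_theta :: "complex \<Rightarrow> complex \<Rightarrow> complex" where
  "partial_theta z \<tau> = 2 * \<i> * (\<Sum>n. (-1) ^ n *
     exp (2 * pi * \<i> * (of_nat n + 1/2) * z) *
     exp (2 * pi * \<i> * ((of_nat n + 1/2)\<^sup>2 / 2) * \<tau>))"

definition partial_theta0 :: "complex \<Rightarrow> complex" where
  "partial_theta0 \<tau> = partial_theta 0 \<tau>"

text \<open>The common domain of the partial Eisenstein series: the upper half-plane without the
  zeros of \<^const>\<open>partial_theta0\<close>, which are their possible poles.\<close>

definition eis_dom :: "complex set" where
  "eis_dom = {\<tau>. Im \<tau> > 0 \<and> partial_theta0 \<tau> \<noteq> 0}"

text \<open>The sequence \<open>g\<close> consists of the coefficients in the expansion around \<open>z = 0\<close> at the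
  fixed point \<open>\<tau>\<close>. Only the indices \<open>k \<ge> 1\<close> carry meaning; the entry at \<open>0\<close> is set to \<open>0\<close>, so
  that the series may start at \<open>k = 0\<close>.\<close>

definition eis_expansion :: "complex \<Rightarrow> (nat \<Rightarrow> complex) \<Rightarrow> bool" where
  "eis_expansion \<tau> g \<longleftrightarrow> g 0 = 0 \<and>
     (\<forall>\<^sub>F z in nhds 0.
        summable (\<lambda>k. g k * (2 * pi * \<i> * z) ^ k / fact k) \<and>
        partial_theta z \<tau> =
          partial_theta0 \<tau> * exp (- (\<Sum>k. g k * (2 * pi * \<i> * z) ^ k / fact k)))"

text \<open>Meaningful for \<open>\<tau>\<close> in \<^const>\<open>eis_dom\<close>; existence and uniqueness of the expansion there
  is \<open>eis_expansion_ex1\<close> below.\<close>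

definition partial_eis :: "nat \<Rightarrow> complex \<Rightarrow> complex" where
  "partial_eis k \<tau> = (THE g. eis_expansion \<tau> g) k"

definition Dq :: "(complex \<Rightarrow> complex) \<Rightarrow> complex \<Rightarrow> complex" where
  "Dq f \<tau> = deriv f \<tau> / (2 * pi * \<i>)"

text \<open>The algebra generated by the partial Eisenstein series. Its elements are functions on
  \<^const>\<open>eis_dom\<close>, represented as extensional functions so that equality of
  elements is equality on \<^const>\<open>eis_dom\<close>.\<close>

inductive_set eis_algebra :: "(complex \<Rightarrow> complex) set" where
  const: "restrict (\<lambda>_. c) eis_dom \<in> eis_algebra"
| gen: "k \<ge> 1 \<Longrightarrow> restrict (partial_eis k) eis_dom \<in> eis_algebra"
| add: "f \<in> eis_algebra \<Longrightarrow> h \<in> eis_algebra \<Longrightarrow> restrict (\<lambda>\<tau>. f \<tau> + h \<tau>) eis_dom \<in> eis_algebra"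
| mult: "f \<in> eis_algebra \<Longrightarrow> h \<in> eis_algebra \<Longrightarrow> restrict (\<lambda>\<tau>. f \<tau> * h \<tau>) eis_dom \<in> eis_algebra"

lemma partial_theta_majorant:
  fixes R c :: real
  assumes "c > 0"
  shows "summable (\<lambda>n. exp (2 * pi * R * (real n + 1/2)) * exp (- (pi * c * (real n + 1/2)\<^sup>2)))"
proof (rule summable_comparison_test_ev)
  have "\<forall>\<^sub>F n in sequentially. exp (2 * pi * R * (real n + 1/2) - pi * c * (real n + 1/2)\<^sup>2) \<le> exp (- real n)"
    using assms by real_asymp
  then show "\<forall>\<^sub>F n in sequentially. norm (exp (2 * pi * R * (real n + 1/2)) * exp (- (pi * c * (real n + 1/2)\<^sup>2))) \<le> exp (-1) ^ n"
    by eventually_elim (simp add: mult_exp_exp flip: exp_of_nat_mult)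
  show "summable (\<lambda>n. exp (-1 :: real) ^ n)"
    by (rule summable_geometric) simp
qed

lemma partial_theta_term_bound:
  fixes z \<tau> :: complex
  assumes "norm z \<le> R" "c \<le> Im \<tau>"
  shows "norm ((-1) ^ n * exp (2 * pi * \<i> * (of_nat n + 1/2) * z) *
     exp (2 * pi * \<i> * ((of_nat n + 1/2)\<^sup>2 / 2) * \<tau>))
     \<le> exp (2 * pi * R * (real n + 1/2)) * exp (- (pi * c * (real n + 1/2)\<^sup>2))"
proof -
  define x where "x = real n + 1/2"
  have x: "x > 0" "(of_nat n + 1/2 :: complex) = of_real x" by (auto simp: x_def)
  have "- Im z \<le> R" using assms(1) abs_Im_le_cmod[of z] by linarith
  then have 1: "x * (pi * (2 * (- Im z))) \<le> x * (pi * (2 * R))"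
    using x by (intro mult_left_mono) auto
  have 2: "x\<^sup>2 * (pi * c) \<le> x\<^sup>2 * (pi * Im \<tau>)"
    using assms by (intro mult_left_mono) auto
  have e1: "norm (exp (2 * pi * \<i> * of_real x * z)) \<le> exp (2 * pi * R * x)"
    using 1 by (simp add: norm_exp_eq_Re algebra_simps)
  have "(2 * pi * \<i> * ((of_real x)\<^sup>2 / 2) * \<tau>) = of_real (pi * x\<^sup>2) * (\<i> * \<tau>)"
    by simp
  then have "Re (2 * pi * \<i> * ((of_real x)\<^sup>2 / 2) * \<tau>) = - (pi * x\<^sup>2 * Im \<tau>)"
    by (simp only: Re_complex_of_real Im_complex_of_real times_complex.sel) simp
  then have e2: "norm (exp (2 * pi * \<i> * ((of_real x)\<^sup>2 / 2) * \<tau>)) \<le> exp (- (pi * c * x\<^sup>2))"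
    using 2 by (simp add: norm_exp_eq_Re algebra_simps)
  show ?thesis
    unfolding x x_def[symmetric] using mult_mono[OF e1 e2] by (simp add: norm_mult norm_power)
qed

lemma partial_theta_holomorphic_z:
  assumes "Im \<tau> > 0"
  shows "(\<lambda>z. partial_theta z \<tau>) holomorphic_on UNIV"
proof -
  let ?t = "\<lambda>n z. (-1) ^ n * exp (2 * pi * \<i> * (of_nat n + 1/2) * z) *
     exp (2 * pi * \<i> * ((of_nat n + 1/2)\<^sup>2 / 2) * \<tau>)"
  have "(\<lambda>z. \<Sum>n. ?t n z) holomorphic_on UNIV"
  proof (rule holomorphic_uniform_sequence)
    show "(\<lambda>z. \<Sum>i<n. ?t i z) holomorphic_on UNIV" for n
      by (intro holomorphic_intros)
    fix x :: complex
    have "uniform_limit (cball x 1) (\<lambda>n z. \<Sum>i<n. ?t i z) (\<lambda>z. \<Sum>n. ?t n z) sequentially"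
    proof (rule Weierstrass_m_test[OF partial_theta_term_bound partial_theta_majorant[OF assms]])
      show "norm z \<le> norm x + 1" if "z \<in> cball x 1" for z
        using that norm_triangle_ineq2[of z x] by (simp add: dist_norm norm_minus_commute)
    qed auto
    then show "\<exists>d>0. cball x d \<subseteq> UNIV \<and>
        uniform_limit (cball x d) (\<lambda>n z. \<Sum>i<n. ?t i z) (\<lambda>z. \<Sum>n. ?t n z) sequentially"
      by (intro exI[of _ 1]) auto
  qed auto
  then show ?thesis
    unfolding partial_theta_def by (intro holomorphic_intros)
qed

lemma partial_theta_holomorphic_tau: "partial_theta z holomorphic_on {\<tau>. Im \<tau> > 0}"
proof -
  let ?t = "\<lambda>n \<tau>. (-1) ^ n * exp (2 * pi * \<i> * (of_nat n + 1/2) * z) *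
     exp (2 * pi * \<i> * ((of_nat n + 1/2)\<^sup>2 / 2) * \<tau>)"
  have "(\<lambda>\<tau>. \<Sum>n. ?t n \<tau>) holomorphic_on {\<tau>. Im \<tau> > 0}"
  proof (rule holomorphic_uniform_sequence)
    show "open {\<tau>. Im \<tau> > 0}" by (rule open_halfspace_Im_gt)
    show "(\<lambda>\<tau>. \<Sum>i<n. ?t i \<tau>) holomorphic_on {\<tau>. Im \<tau> > 0}" for n
      by (intro holomorphic_intros)
    fix x :: complex assume x: "x \<in> {\<tau>. Im \<tau> > 0}"
    have c: "Im x / 2 \<le> Im \<tau>" if "\<tau> \<in> cball x (Im x / 2)" for \<tau>
      using that abs_Im_le_cmod[of "x - \<tau>"] by (simp add: dist_norm)
    have "uniform_limit (cball x (Im x / 2)) (\<lambda>n \<tau>. \<Sum>i<n. ?t i \<tau>) (\<lambda>\<tau>. \<Sum>n. ?t n \<tau>) sequentially"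
      by (rule Weierstrass_m_test[OF partial_theta_term_bound[OF order_refl c] partial_theta_majorant])
         (use x in auto)
    then show "\<exists>d>0. cball x d \<subseteq> {\<tau>. Im \<tau> > 0} \<and>
        uniform_limit (cball x d) (\<lambda>n \<tau>. \<Sum>i<n. ?t i \<tau>) (\<lambda>\<tau>. \<Sum>n. ?t n \<tau>) sequentially"
      using x c by (intro exI[of _ "Im x / 2"]) fastforce
  qed
  then show ?thesis
    unfolding partial_theta_def by (intro holomorphic_intros)
qed

lemma partial_theta0_holomorphic: "partial_theta0 holomorphic_on {\<tau>. Im \<tau> > 0}"
  using partial_theta_holomorphic_tau[of 0] by (simp add: partial_theta0_def[abs_def])

lemma open_eis_dom: "open eis_dom"
proof -
  have "open ({\<tau>. Im \<tau> > 0} \<inter> partial_theta0 -` (- {0}))"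
    by (intro continuous_open_preimage holomorphic_on_imp_continuous_on
          partial_theta0_holomorphic open_halfspace_Im_gt) auto
  also have "{\<tau>. Im \<tau> > 0} \<inter> partial_theta0 -` (- {0}) = eis_dom"
    by (auto simp: eis_dom_def)
  finally show ?thesis .
qed

lemma eis_expansion_exists:
  assumes "\<tau> \<in> eis_dom"
  shows "\<exists>g. eis_expansion \<tau> g"
proof -
  define h where "h = (\<lambda>z. partial_theta z \<tau> / partial_theta0 \<tau>)"
  have im: "Im \<tau> > 0" and nz: "partial_theta0 \<tau> \<noteq> 0"
    using assms by (auto simp: eis_dom_def)
  have hol: "h holomorphic_on UNIV"
    unfolding h_def using nz by (intro holomorphic_intros partial_theta_holomorphic_z im) auto
  have h0: "h 0 = 1" using nz by (simp add: h_def partial_theta0_def)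
  have "isCont h 0"
    using hol holomorphic_on_imp_continuous_on continuous_on_eq_continuous_at by blast
  then obtain r where r: "r > 0" "\<And>z. dist 0 z < r \<Longrightarrow> h z \<noteq> 0"
    using continuous_at_avoid[of 0 h 0] h0 by auto
  obtain L where L: "L holomorphic_on ball 0 r" "\<And>z. z \<in> ball 0 r \<Longrightarrow> exp (L z) = h z"
    using holomorphic_logarithm_exists[of "ball 0 r" h 0] hol r holomorphic_on_subset[OF hol]
    by (metis centre_in_ball convex_ball mem_ball open_ball subset_UNIV)
  define M where "M = (\<lambda>z. L 0 - L z)"
  have M: "M holomorphic_on ball 0 r"
    unfolding M_def by (intro holomorphic_intros L)
  have expL0: "exp (L 0) = 1" using L(2)[of 0] r h0 by simp
  have expM: "exp (- M z) = h z" if "z \<in> ball 0 r" for z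
    using L(2)[OF that] expL0 by (simp add: M_def exp_diff)
  define g where "g = (\<lambda>k. (deriv ^^ k) M 0 / (2 * pi * \<i>) ^ k)"
  have g: "(\<lambda>k. g k * (2 * pi * \<i> * z) ^ k / fact k) sums M z" if "z \<in> ball 0 r" for z
    using holomorphic_power_series[OF M that] by (simp add: g_def power_mult_distrib)
  have "eis_expansion \<tau> g"
    unfolding eis_expansion_def
  proof (intro conjI)
    show "g 0 = 0" by (simp add: g_def M_def)
    have "\<forall>\<^sub>F z in nhds 0. z \<in> ball (0::complex) r"
      using r by (intro eventually_nhds_in_open) auto
    then show "\<forall>\<^sub>F z in nhds 0.
        summable (\<lambda>k. g k * (2 * pi * \<i> * z) ^ k / fact k) \<and>
        partial_theta z \<tau> =
          partial_theta0 \<tau> * exp (- (\<Sum>k. g k * (2 * pi * \<i> * z) ^ k / fact k))"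
    proof eventually_elim
      case (elim z)
      show ?case
        using sums_summable[OF g[OF elim]] sums_unique[OF g[OF elim], symmetric] expM[OF elim] nz
        by (simp add: h_def)
    qed
  qed
  then show ?thesis by blast
qed

lemma eis_expansion_fps:
  assumes "eis_expansion \<tau> g"
  defines "F \<equiv> Abs_fps (\<lambda>k. g k * (2 * pi * \<i>) ^ k / fact k)"
  shows "fps_conv_radius F > 0" "eval_fps F 0 = 0"
    "\<forall>\<^sub>F z in nhds 0. partial_theta z \<tau> = partial_theta0 \<tau> * exp (- eval_fps F z)"
proof -
  have eq: "g k * (2 * pi * \<i> * z) ^ k / fact k = fps_nth F k * z ^ k" for k z
    by (simp add: F_def power_mult_distrib)
  have ev: "\<forall>\<^sub>F z in nhds 0. summable (\<lambda>k. fps_nth F k * z ^ k) \<and>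
      partial_theta z \<tau> = partial_theta0 \<tau> * exp (- eval_fps F z)"
    using assms(1) unfolding eis_expansion_def eq eval_fps_def by blast
  then show "\<forall>\<^sub>F z in nhds 0. partial_theta z \<tau> = partial_theta0 \<tau> * exp (- eval_fps F z)"
    by eventually_elim auto
  from ev obtain e where e: "e > 0" "\<And>z. dist z 0 < e \<Longrightarrow> summable (\<lambda>k. fps_nth F k * z ^ k)"
    unfolding eventually_nhds_metric by auto
  have "summable (\<lambda>k. fps_nth F k * (of_real (e/2)) ^ k)"
    using e(1) by (intro e(2)) simp
  then have "conv_radius (fps_nth F) \<ge> norm (of_real (e/2) :: complex)"
    by (rule conv_radius_geI)
  moreover have "ereal (norm (of_real (e/2) :: complex)) > 0"
    using e(1) by simp
  ultimately show "fps_conv_radius F > 0"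
    unfolding fps_conv_radius_def by (rule less_le_trans[rotated])
  show "eval_fps F 0 = 0"
    using assms(1) by (simp add: eval_fps_at_0 F_def eis_expansion_def)
qed

lemma eis_expansion_unique:
  assumes \<tau>: "\<tau> \<in> eis_dom" and a: "eis_expansion \<tau> a" and b: "eis_expansion \<tau> b"
  shows "a = b"
proof -
  define F where "F = Abs_fps (\<lambda>k. a k * (2 * pi * \<i>) ^ k / fact k)"
  define G where "G = Abs_fps (\<lambda>k. b k * (2 * pi * \<i>) ^ k / fact k)"
  note F = eis_expansion_fps[OF a, folded F_def] and G = eis_expansion_fps[OF b, folded G_def]
  have nz: "partial_theta0 \<tau> \<noteq> 0" using \<tau> by (simp add: eis_dom_def)
  have small: "\<forall>\<^sub>F z in nhds 0. norm (eval_fps H z) < pi"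
    if H: "fps_conv_radius H > 0" "eval_fps H 0 = 0" for H :: "complex fps"
  proof -
    have "isCont (eval_fps H) 0"
      using H continuous_eval_fps[of 0 H UNIV] by (simp add: zero_ereal_def)
    then have "(eval_fps H \<longlongrightarrow> 0) (nhds 0)"
      using H by (simp add: isCont_def tendsto_nhds_iff)
    then have "((\<lambda>z. norm (eval_fps H z)) \<longlongrightarrow> 0) (nhds 0)"
      by (rule tendsto_norm_zero)
    then show ?thesis by (rule order_tendstoD) simp
  qed
  have "\<forall>\<^sub>F z in nhds 0. eval_fps F z = eval_fps G z"
    using F(3) G(3) small[OF F(1,2)] small[OF G(1,2)]
  proof eventually_elim
    case (elim z)
    have "exp (- eval_fps F z) = exp (- eval_fps G z)" using elim nz by simp
    moreover have "\<bar>Im (- eval_fps F z) - Im (- eval_fps G z)\<bar> < 2 * pi"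
      using elim abs_Im_le_cmod[of "eval_fps F z"] abs_Im_le_cmod[of "eval_fps G z"] by simp
    ultimately have "- eval_fps F z = - eval_fps G z" by (rule exp_complex_eqI[rotated])
    then show ?case by simp
  qed
  then have "F = G" by (rule eval_fps_eqD[OF F(1) G(1)])
  then have "fps_nth F k = fps_nth G k" for k by simp
  then show "a = b" by (simp add: F_def G_def fun_eq_iff)
qed

lemma eis_expansion_ex1: "\<tau> \<in> eis_dom \<Longrightarrow> \<exists>!g. eis_expansion \<tau> g"
  using eis_expansion_exists eis_expansion_unique by blast

lemma eis_expansion_partial_eis:
  "\<tau> \<in> eis_dom \<Longrightarrow> eis_expansion \<tau> (\<lambda>k. partial_eis k \<tau>)"
  unfolding partial_eis_def by (rule theI'[OF eis_expansion_ex1])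

end

theory Submission
  imports Defs
begin

text \<open>The partial theta function satisfies the heat equation
  \<open>D T = (\<partial>/\<partial>u)\<^sup>2 T / 2\<close> with \<open>u = 2 \<pi> \<i> z\<close>. Writing
  \<open>T = T\<^sub>0 exp (-G)\<close> and dividing by \<open>T\<close> turns it into
  \<open>D (Log T\<^sub>0) - D G = (G'\<^sup>2 - G'') / 2\<close>; comparing the Taylor coefficients in \<open>u\<close>
  yields all the formulas. To avoid differentiating \<open>G\<close> under the expansion, the argument is carried out
  with formal power series in \<open>z\<close> whose coefficients are holomorphic in \<open>\<tau>\<close>.\<close>

section \<open>Termwise differentiation of locally dominated series\<close>

text \<open>The functions that \<open>series_and_derivative_comparison_local\<close> only asserts to
  exist are replaced by the explicit series. The terms are complex differentiable on an open set, so
  a local bound on \<open>f n\<close> suffices and none is asked of \<open>f' n\<close>.\<close>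

lemma has_field_derivative_suminf_local:
  fixes f f' :: "nat \<Rightarrow> complex \<Rightarrow> complex"
  assumes "open S" "x \<in> S"
    and "\<And>n x. x \<in> S \<Longrightarrow> (f n has_field_derivative f' n x) (at x)"
    and "\<And>x. x \<in> S \<Longrightarrow> \<exists>d h. 0 < d \<and> summable h \<and>
           (\<forall>\<^sub>F n in sequentially. \<forall>y\<in>ball x d \<inter> S. norm (f n y) \<le> h n)"
  shows "((\<lambda>x. \<Sum>n. f n x) has_field_derivative (\<Sum>n. f' n x)) (at x)"
proof -
  obtain g g' where *: "\<forall>x\<in>S. (\<lambda>n. f n x) sums g x \<and> (\<lambda>n. f' n x) sums g' x \<and>
      (g has_field_derivative g' x) (at x)"
    using series_and_derivative_comparison_local[OF assms(1,3,4)] by blast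
  have "((\<lambda>x. \<Sum>n. f n x) has_field_derivative g' x) (at x)"
    by (rule has_field_derivative_transform_within_open[of g _ _ S])
       (use * assms(1,2) in \<open>auto simp: sums_iff\<close>)
  then show ?thesis
    using * assms(2) by (auto simp: sums_iff)
qed

text \<open>A single term of the exponential series is at most its sum. This serves to absorb
  polynomial weights into an exponential.\<close>

lemma power_le_fact_mult_exp:
  fixes x :: real
  assumes "x \<ge> 0"
  shows "x ^ n \<le> fact n * exp x"
proof -
  have "x ^ n /\<^sub>R fact n \<le> (\<Sum>k. x ^ k /\<^sub>R fact k)"
    using sum_le_suminf[OF summable_exp_generic[of x], of "{n}"] assms by simp
  then show ?thesis
    by (simp add: exp_def field_simps)
qed

section \<open>Moments of the partial theta series and their derivatives\<close>

definition theta_term :: "nat \<Rightarrow> nat \<Rightarrow> complex \<Rightarrow> complex \<Rightarrow> complex" where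
  "theta_term j n z \<tau> = (of_nat n + 1/2) ^ j * ((-1) ^ n *
     exp (2 * pi * \<i> * (of_nat n + 1/2) * z) *
     exp (2 * pi * \<i> * ((of_nat n + 1/2)\<^sup>2 / 2) * \<tau>))"

text \<open>This is the \<open>j\<close>-th derivative of T with respect to u = 2 pi i z.\<close>

definition theta_moment :: "nat \<Rightarrow> complex \<Rightarrow> complex \<Rightarrow> complex" where
  "theta_moment j z \<tau> = 2 * \<i> * (\<Sum>n. theta_term j n z \<tau>)"

lemma theta_moment_0: "theta_moment 0 = partial_theta"
  by (simp add: theta_moment_def theta_term_def partial_theta_def fun_eq_iff)

text \<open>The weight \<open>(n + 1/2) ^ j\<close> costs an extra factor
  \<open>fact j * exp (2 * pi * (n + 1/2))\<close>, which, apart from the constant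
  \<open>fact j\<close>, merely replaces \<open>R\<close> by \<open>R + 1\<close> in the majorant of
  \<open>partial_theta\<close>.\<close>

lemma theta_term_bound:
  assumes "norm z \<le> R" "c \<le> Im \<tau>"
  shows "norm (theta_term j n z \<tau>) \<le>
    fact j * (exp (2 * pi * (R + 1) * (real n + 1/2)) * exp (- (pi * c * (real n + 1/2)\<^sup>2)))"
proof -
  define x where "x = real n + 1/2"
  define E where "E = exp (- (pi * c * x\<^sup>2))"
  define t where "t = (-1) ^ n * exp (2 * pi * \<i> * (of_nat n + 1/2) * z) *
     exp (2 * pi * \<i> * ((of_nat n + 1/2)\<^sup>2 / 2) * \<tau>)"
  have x: "x > 0" "(of_nat n + 1/2 :: complex) = of_real x" by (auto simp: x_def)
  \<comment> \<open>Enlarging \<open>exp x\<close> to \<open>exp (2 * pi * x)\<close> gives it the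
    shape of the majorant.\<close>
  have "x * 1 \<le> x * (2 * pi)"
    using x pi_gt3 by (intro mult_left_mono) auto
  then have "exp x \<le> exp (2 * pi * x)"
    by (simp add: mult_ac)
  then have 1: "x ^ j \<le> fact j * exp (2 * pi * x)"
    using power_le_fact_mult_exp[of x j] x
    by (meson fact_ge_zero less_eq_real_def mult_left_mono order_trans)
  have 2: "norm t \<le> exp (2 * pi * R * x) * E"
    using partial_theta_term_bound[OF assms] unfolding t_def x_def E_def .
  have "theta_term j n z \<tau> = of_real x ^ j * t"
    by (simp add: theta_term_def t_def x_def)
  then have "norm (theta_term j n z \<tau>) = x ^ j * norm t"
    using x(1) by (simp add: norm_mult norm_power)
  also have "\<dots> \<le> (fact j * exp (2 * pi * x)) * (exp (2 * pi * R * x) * E)"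
    using x by (intro mult_mono 1 2) auto
  also have "\<dots> = fact j * (exp (2 * pi * (R + 1) * x) * E)"
    by (simp add: mult_exp_exp algebra_simps)
  finally show ?thesis by (simp add: x_def E_def)
qed

lemma theta_term_majorant:
  assumes "c > 0"
  shows "summable (\<lambda>n. fact j * (exp (2 * pi * (R + 1) * (real n + 1/2)) * exp (- (pi * c * (real n + 1/2)\<^sup>2))))"
  by (intro summable_mult partial_theta_majorant assms)

lemma summable_theta_term: "Im \<tau> > 0 \<Longrightarrow> summable (\<lambda>n. theta_term j n z \<tau>)"
  by (rule summable_comparison_test'[OF theta_term_majorant theta_term_bound[OF order_refl order_refl]])

text \<open>Each differentiation in z brings down the factor 2 pi i (n + 1/2) and thus raises the
  moment by one.\<close>

lemma theta_moment_deriv_z: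
  assumes "Im \<tau> > 0"
  shows "((\<lambda>z. theta_moment j z \<tau>) has_field_derivative
    2 * pi * \<i> * theta_moment (Suc j) z \<tau>) (at z)"
proof -
  have "((\<lambda>z. \<Sum>n. theta_term j n z \<tau>) has_field_derivative
      (\<Sum>n. 2 * pi * \<i> * theta_term (Suc j) n z \<tau>)) (at z)"
  proof (rule has_field_derivative_suminf_local[of UNIV])
    show "((\<lambda>z. theta_term j n z \<tau>) has_field_derivative
        2 * pi * \<i> * theta_term (Suc j) n z \<tau>) (at z)" for n z
      unfolding theta_term_def
      by (auto intro!: derivative_eq_intros)
    fix x :: complex
    have "norm y \<le> norm x + 1" if "y \<in> ball x 1" for y
      using that norm_triangle_ineq2[of y x] by (simp add: dist_norm norm_minus_commute)
    then show "\<exists>d h. (0::real) < d \<and> summable h \<and>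
        (\<forall>\<^sub>F n in sequentially. \<forall>y\<in>ball x d \<inter> UNIV. norm (theta_term j n y \<tau>) \<le> h n)"
      using theta_term_bound[OF _ order_refl] theta_term_majorant[OF assms, of j "norm x + 1"] zero_less_one
      by (intro exI[of _ 1] exI conjI always_eventually allI ballI) blast+
  qed auto
  then have "((\<lambda>z. 2 * \<i> * (\<Sum>n. theta_term j n z \<tau>)) has_field_derivative
      2 * \<i> * (\<Sum>n. 2 * pi * \<i> * theta_term (Suc j) n z \<tau>)) (at z)"
    by (rule DERIV_cmult)
  then show ?thesis
    unfolding suminf_mult[OF summable_theta_term[OF assms]] theta_moment_def by (simp only: mult_ac)
qed

text \<open>Differentiation in \<tau> brings down pi i (n + 1/2)^2, which is worth two moments at
  once. Together with \<open>theta_moment_deriv_z\<close> this contains the heat equation.\<close>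

lemma theta_moment_deriv_tau:
  assumes "Im \<tau> > 0"
  shows "(theta_moment j z has_field_derivative pi * \<i> * theta_moment (j + 2) z \<tau>) (at \<tau>)"
proof -
  have "((\<lambda>\<tau>. \<Sum>n. theta_term j n z \<tau>) has_field_derivative
      (\<Sum>n. pi * \<i> * theta_term (j + 2) n z \<tau>)) (at \<tau>)"
  proof (rule has_field_derivative_suminf_local[of "{\<tau>. Im \<tau> > 0}"])
    show "(theta_term j n z has_field_derivative pi * \<i> * theta_term (j + 2) n z \<tau>) (at \<tau>)" for n \<tau>
      unfolding theta_term_def
      by (auto intro!: derivative_eq_intros simp: power2_eq_square)
    fix x assume "x \<in> {\<tau>. Im \<tau> > 0}"
    \<comment> \<open>On the ball of radius \<open>Im x / 2\<close> the imaginary part stays above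
      \<open>Im x / 2\<close>, so one majorant serves the whole ball.\<close>
    then have x: "0 < Im x / 2" by simp
    have "Im x / 2 \<le> Im y" if "y \<in> ball x (Im x / 2)" for y
      using that abs_Im_le_cmod[of "x - y"] by (simp add: dist_norm)
    then show "\<exists>d h. 0 < d \<and> summable h \<and>
        (\<forall>\<^sub>F n in sequentially. \<forall>y\<in>ball x d \<inter> {\<tau>. Im \<tau> > 0}. norm (theta_term j n z y) \<le> h n)"
      using theta_term_bound[OF order_refl] theta_term_majorant[of "Im x / 2" j "norm z"] x
      by (intro exI[of _ "Im x / 2"] exI conjI always_eventually allI ballI) blast+
  qed (use assms open_halfspace_Im_gt in auto)
  then have "((\<lambda>\<tau>. 2 * \<i> * (\<Sum>n. theta_term j n z \<tau>)) has_field_derivative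
      2 * \<i> * (\<Sum>n. pi * \<i> * theta_term (j + 2) n z \<tau>)) (at \<tau>)"
    by (rule DERIV_cmult)
  then show ?thesis
    unfolding suminf_mult[OF summable_theta_term[OF assms]] theta_moment_def[abs_def] by (simp only: mult_ac)
qed

lemma higher_deriv_partial_theta:
  assumes "Im \<tau> > 0"
  shows "(deriv ^^ n) (\<lambda>z. partial_theta z \<tau>) = (\<lambda>z. (2 * pi * \<i>) ^ n * theta_moment n z \<tau>)"
proof (induction n)
  case 0
  then show ?case by (simp add: theta_moment_0)
next
  case (Suc n)
  have "((\<lambda>z. (2 * pi * \<i>) ^ n * theta_moment n z \<tau>) has_field_derivative
      (2 * pi * \<i>) ^ n * (2 * pi * \<i> * theta_moment (Suc n) z \<tau>)) (at z)" for z
    by (intro DERIV_cmult theta_moment_deriv_z assms)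
  then show ?case
    by (simp add: Suc fun_eq_iff DERIV_imp_deriv mult_ac)
qed

section \<open>Formal power series in z for T and for the exponent G\<close>

text \<open>The exponential generating function of \<open>a\<close> in the variable c z. With c = 2
  pi i the coefficients refer to u, while the formal variable remains z.\<close>

definition egf :: "complex \<Rightarrow> (nat \<Rightarrow> complex) \<Rightarrow> complex fps" where
  "egf c a = Abs_fps (\<lambda>n. c ^ n / fact n * a n)"

lemma egf_nth: "fps_nth (egf c a) n = c ^ n / fact n * a n"
  by (simp add: egf_def)

lemma fps_deriv_egf: "fps_deriv (egf c a) = egf c (\<lambda>n. c * a (Suc n))"
  by (simp add: fps_eq_iff egf_nth mult.commute[of c] flip: of_nat_Suc del: of_nat_Suc)

text \<open>Exponential generating functions multiply by binomial convolution; the binomials in the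
  formula for D(g_k) come from here.\<close>

lemma egf_mult: "egf c a * egf c b = egf c (\<lambda>k. \<Sum>d=0..k. of_nat (k choose d) * a d * b (k - d))"
proof (rule fps_ext)
  fix k
  have "fps_nth (egf c a) d * fps_nth (egf c b) (k - d) = c ^ k / fact k * (of_nat (k choose d) * a d * b (k - d))"
    if "d \<le> k" for d
  proof -
    have "c ^ k = c ^ d * c ^ (k - d)"
      using that by (simp flip: power_add)
    moreover have "of_nat (k choose d) = (fact k / (fact d * fact (k - d)) :: complex)"
      using that by (simp add: binomial_fact)
    ultimately show ?thesis
      by (simp add: egf_nth)
  qed
  then show "fps_nth (egf c a * egf c b) k =
      fps_nth (egf c (\<lambda>k. \<Sum>d=0..k. of_nat (k choose d) * a d * b (k - d))) k"
    by (simp add: fps_mult_nth egf_nth[of c "\<lambda>k. \<Sum>d=0..k. _ k d"] sum_distrib_left)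
qed

definition theta_fps :: "complex \<Rightarrow> complex fps" where
  "theta_fps \<tau> = egf (2 * pi * \<i>) (\<lambda>n. theta_moment n 0 \<tau>)"

text \<open>The exponent G in T = T_0 exp(-G).\<close>

definition eis_fps :: "complex \<Rightarrow> complex fps" where
  "eis_fps \<tau> = egf (2 * pi * \<i>) (\<lambda>k. partial_eis k \<tau>)"

lemma theta_fps_expansion:
  assumes "Im \<tau> > 0"
  shows "(\<lambda>z. partial_theta z \<tau>) has_fps_expansion theta_fps \<tau>"
proof -
  have "theta_fps \<tau> = fps_expansion (\<lambda>z. partial_theta z \<tau>) 0"
    using higher_deriv_partial_theta[OF assms]
    by (simp add: theta_fps_def egf_def fps_expansion_def)
  then show ?thesis
    using has_fps_expansion_fps_expansion[OF open_UNIV UNIV_I partial_theta_holomorphic_z[OF assms]]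
    by simp
qed

lemma theta_fps_nth_0: "fps_nth (theta_fps \<tau>) 0 = partial_theta0 \<tau>"
  by (simp add: theta_fps_def egf_nth theta_moment_0 partial_theta0_def)

text \<open>Differentiating T = T_0 exp(-G) in z gives T' = -T G' near 0, and uniqueness of
  expansions carries this over to formal series. In this form no formal exponential or logarithm
  occurs.\<close>

lemma fps_deriv_theta_fps:
  assumes "\<tau> \<in> eis_dom"
  shows "fps_deriv (theta_fps \<tau>) = - (theta_fps \<tau> * fps_deriv (eis_fps \<tau>))"
proof -
  have "eis_fps \<tau> = Abs_fps (\<lambda>k. partial_eis k \<tau> * (2 * pi * \<i>) ^ k / fact k)"
    by (simp add: eis_fps_def egf_def mult.commute)
  note F = eis_expansion_fps[OF eis_expansion_partial_eis[OF assms], folded this]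
  have im: "Im \<tau> > 0" using assms by (simp add: eis_dom_def)
  note A = theta_fps_expansion[OF im]
  have FE: "eval_fps (eis_fps \<tau>) has_fps_expansion eis_fps \<tau>"
    using F(1) by (rule eval_fps_has_fps_expansion)
  have "\<forall>\<^sub>F z in nhds 0. z \<in> eball 0 (fps_conv_radius (eis_fps \<tau>))"
    using F(1) by (intro eventually_nhds_in_open) (auto simp: zero_ereal_def)
  \<comment> \<open>To differentiate the identity at z, it must hold on a whole neighbourhood of
    z.\<close>
  moreover have "\<forall>\<^sub>F z in nhds 0. \<forall>\<^sub>F w in nhds z.
      partial_theta w \<tau> = partial_theta0 \<tau> * exp (- eval_fps (eis_fps \<tau>) w)"
    using F(3) by (simp add: eventually_eventually)
  ultimately have "\<forall>\<^sub>F z in nhds 0. deriv (\<lambda>z. partial_theta z \<tau>) z =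
      - (partial_theta z \<tau> * deriv (eval_fps (eis_fps \<tau>)) z)"
  proof eventually_elim
    case (elim z)
    have d: "(eval_fps (eis_fps \<tau>) has_field_derivative deriv (eval_fps (eis_fps \<tau>)) z) (at z)"
      by (rule holomorphic_derivI[OF holomorphic_on_eval_fps[OF order_refl] open_eball elim(1)])
    have "deriv (\<lambda>z. partial_theta z \<tau>) z =
        deriv (\<lambda>w. partial_theta0 \<tau> * exp (- eval_fps (eis_fps \<tau>) w)) z"
      by (rule deriv_cong_ev[OF elim(2) refl])
    also have "\<dots> = - (partial_theta0 \<tau> * exp (- eval_fps (eis_fps \<tau>) z) * deriv (eval_fps (eis_fps \<tau>)) z)"
      by (rule DERIV_imp_deriv) (rule derivative_eq_intros d refl | simp)+
    also have "\<dots> = - (partial_theta z \<tau> * deriv (eval_fps (eis_fps \<tau>)) z)"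
      using eventually_nhds_x_imp_x[OF elim(2)] by simp
    finally show ?case .
  qed
  then have "deriv (\<lambda>z. partial_theta z \<tau>) has_fps_expansion - (theta_fps \<tau> * fps_deriv (eis_fps \<tau>))
      \<longleftrightarrow> (\<lambda>z. - (partial_theta z \<tau> * deriv (eval_fps (eis_fps \<tau>)) z)) has_fps_expansion
        - (theta_fps \<tau> * fps_deriv (eis_fps \<tau>))"
    by (intro has_fps_expansion_cong refl)
  then have "deriv (\<lambda>z. partial_theta z \<tau>) has_fps_expansion - (theta_fps \<tau> * fps_deriv (eis_fps \<tau>))"
    by (auto intro!: fps_expansion_intros A FE)
  with has_fps_expansion_deriv[OF A] show ?thesis
    by (rule fps_expansion_unique_complex)
qed

section \<open>Coefficientwise differentiation in \<tau> and the heat equation\<close>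

text \<open>Differentiating coefficient by coefficient raises no question of convergence or of
  interchanging limits.\<close>

definition fps_has_deriv :: "(complex \<Rightarrow> complex fps) \<Rightarrow> complex fps \<Rightarrow> complex \<Rightarrow> bool" where
  "fps_has_deriv F F' \<tau> \<longleftrightarrow> (\<forall>n. ((\<lambda>t. fps_nth (F t) n) has_field_derivative fps_nth F' n) (at \<tau>))"

lemma fps_has_deriv_unique: "fps_has_deriv F G \<tau> \<Longrightarrow> fps_has_deriv F H \<tau> \<Longrightarrow> G = H"
  unfolding fps_has_deriv_def fps_eq_iff by (blast intro: DERIV_unique)

lemma fps_has_deriv_transform:
  "fps_has_deriv F F' \<tau> \<Longrightarrow> open S \<Longrightarrow> \<tau> \<in> S \<Longrightarrow> (\<And>t. t \<in> S \<Longrightarrow> F t = G t) \<Longrightarrow> fps_has_deriv G F' \<tau>"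
  unfolding fps_has_deriv_def by (auto intro: has_field_derivative_transform_within_open)

lemma fps_has_deriv_uminus: "fps_has_deriv F F' \<tau> \<Longrightarrow> fps_has_deriv (\<lambda>t. - F t) (- F') \<tau>"
  unfolding fps_has_deriv_def by (auto intro: DERIV_minus)

text \<open>Derivatives in z and \<tau> commute, because \<open>fps_deriv\<close> only shifts the
  coefficients and multiplies them by constants.\<close>

lemma fps_has_deriv_fps_deriv:
  "fps_has_deriv F F' \<tau> \<Longrightarrow> fps_has_deriv (\<lambda>t. fps_deriv (F t)) (fps_deriv F') \<tau>"
  unfolding fps_has_deriv_def by (auto intro!: derivative_eq_intros)

text \<open>Each coefficient of a product is a finite sum of products, so the ordinary product rule
  applies.\<close>

lemma fps_has_deriv_mult:
  assumes "fps_has_deriv F F' \<tau>" "fps_has_deriv G G' \<tau>"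
  shows "fps_has_deriv (\<lambda>t. F t * G t) (F' * G \<tau> + F \<tau> * G') \<tau>"
  using assms unfolding fps_has_deriv_def fps_mult_nth fps_add_nth sum.distrib[symmetric]
  by (auto intro!: DERIV_sum derivative_eq_intros)

text \<open>The heat equation. The constant is the quotient of the factor pi i from one
  \<tau>-derivative by the factor (2 pi i)^2 from two z-derivatives.\<close>

lemma theta_fps_has_deriv:
  assumes "Im \<tau> > 0"
  shows "fps_has_deriv theta_fps (fps_const (1 / (4 * pi * \<i>)) * fps_deriv (fps_deriv (theta_fps \<tau>))) \<tau>"
  unfolding fps_has_deriv_def
proof
  fix n
  have "((\<lambda>t. (2 * pi * \<i>) ^ n / fact n * theta_moment n 0 t) has_field_derivative
      (2 * pi * \<i>) ^ n / fact n * (pi * \<i> * theta_moment (n + 2) 0 \<tau>)) (at \<tau>)"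
    by (intro DERIV_cmult theta_moment_deriv_tau assms)
  moreover have "fps_nth (fps_const (1 / (4 * pi * \<i>)) * fps_deriv (fps_deriv (theta_fps \<tau>))) n =
      (2 * pi * \<i>) ^ n / fact n * (pi * \<i> * theta_moment (n + 2) 0 \<tau>)"
    by (simp add: theta_fps_def fps_deriv_egf egf_nth mult_ac)
  ultimately show "((\<lambda>t. fps_nth (theta_fps t) n) has_field_derivative
      fps_nth (fps_const (1 / (4 * pi * \<i>)) * fps_deriv (fps_deriv (theta_fps \<tau>))) n) (at \<tau>)"
    by (simp only: theta_fps_def egf_nth)
qed

text \<open>The recursion comes from comparing coefficients in \<open>T' = - T G'\<close>.\<close>

lemma eis_fps_nth_Suc:
  assumes "\<tau> \<in> eis_dom"
  shows "fps_nth (eis_fps \<tau>) (Suc n) =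
    - (of_nat (Suc n) * fps_nth (theta_fps \<tau>) (Suc n) +
       (\<Sum>i=1..n. fps_nth (theta_fps \<tau>) i * (of_nat (Suc (n - i)) * fps_nth (eis_fps \<tau>) (Suc (n - i)))))
    / (of_nat (Suc n) * partial_theta0 \<tau>)"
proof -
  have nz: "partial_theta0 \<tau> \<noteq> 0" using assms by (simp add: eis_dom_def)
  have "fps_nth (fps_deriv (theta_fps \<tau>)) n = - fps_nth (theta_fps \<tau> * fps_deriv (eis_fps \<tau>)) n"
    using fps_deriv_theta_fps[OF assms] by simp
  \<comment> \<open>The term i = 0 is split off, being the only one that contains the new
    coefficient \<open>Suc n\<close> of G.\<close>
  also have "fps_nth (theta_fps \<tau> * fps_deriv (eis_fps \<tau>)) n =
    partial_theta0 \<tau> * (of_nat (Suc n) * fps_nth (eis_fps \<tau>) (Suc n)) +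
    (\<Sum>i=1..n. fps_nth (theta_fps \<tau>) i * (of_nat (Suc (n - i)) * fps_nth (eis_fps \<tau>) (Suc (n - i))))"
    by (simp add: fps_mult_nth sum.atLeast_Suc_atMost theta_fps_nth_0 del: of_nat_Suc)
  finally have "of_nat (Suc n) * fps_nth (theta_fps \<tau>) (Suc n) = - (partial_theta0 \<tau> * (of_nat (Suc n) * fps_nth (eis_fps \<tau>) (Suc n)) +
    (\<Sum>i=1..n. fps_nth (theta_fps \<tau>) i * (of_nat (Suc (n - i)) * fps_nth (eis_fps \<tau>) (Suc (n - i)))))"
    by (simp del: of_nat_Suc)
  moreover have "of_nat (Suc n) * partial_theta0 \<tau> \<noteq> 0"
    using nz by (simp del: of_nat_Suc)
  ultimately show ?thesis
    by (simp add: eq_divide_eq mult_ac del: of_nat_Suc)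
qed

section \<open>Holomorphy of the partial Eisenstein series\<close>

lemma theta_fps_nth_holomorphic: "(\<lambda>\<tau>. fps_nth (theta_fps \<tau>) n) holomorphic_on eis_dom"
  unfolding holomorphic_on_open[OF open_eis_dom]
  using theta_fps_has_deriv unfolding fps_has_deriv_def eis_dom_def by blast

text \<open>The pointwise description defining \<open>partial_eis\<close> says nothing about
  regularity in \<tau>. The recursion does: it builds each coefficient from earlier ones and those
  of T, dividing only by a multiple of T_0, which has no zero on \<open>eis_dom\<close>.\<close>

lemma eis_fps_nth_holomorphic: "(\<lambda>\<tau>. fps_nth (eis_fps \<tau>) n) holomorphic_on eis_dom"
proof (induction n rule: less_induct)
  case (less n)
  show ?case
  proof (cases n)
    case 0
    \<comment> \<open>The recursion does not reach index 0, which is settled by the convention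
      \<open>g 0 = 0\<close> in \<open>eis_expansion\<close>.\<close>
    have "fps_nth (eis_fps \<tau>) 0 = 0" if "\<tau> \<in> eis_dom" for \<tau>
      using eis_expansion_partial_eis[OF that] by (simp add: eis_expansion_def eis_fps_def egf_nth)
    then show ?thesis
      unfolding 0 by (simp add: holomorphic_on_const cong: holomorphic_cong)
  next
    case (Suc m)
    have nz: "of_nat (Suc m) * partial_theta0 \<tau> \<noteq> 0" if "\<tau> \<in> eis_dom" for \<tau>
      using that by (simp add: eis_dom_def del: of_nat_Suc)
    have "(\<lambda>\<tau>. - (of_nat (Suc m) * fps_nth (theta_fps \<tau>) (Suc m) +
       (\<Sum>i=1..m. fps_nth (theta_fps \<tau>) i * (of_nat (Suc (m - i)) * fps_nth (eis_fps \<tau>) (Suc (m - i)))))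
        / (of_nat (Suc m) * partial_theta0 \<tau>)) holomorphic_on eis_dom"
    proof (intro holomorphic_on_divide holomorphic_on_minus holomorphic_on_add holomorphic_on_sum
        holomorphic_on_mult holomorphic_on_const theta_fps_nth_holomorphic nz)
      show "partial_theta0 holomorphic_on eis_dom"
        by (rule holomorphic_on_subset[OF partial_theta0_holomorphic]) (auto simp: eis_dom_def)
      show "(\<lambda>\<tau>. fps_nth (eis_fps \<tau>) (Suc (m - i))) holomorphic_on eis_dom" if "i \<in> {1..m}" for i
        using that Suc by (intro less.IH) auto
    qed
    then show ?thesis
      unfolding Suc by (rule holomorphic_transform) (rule eis_fps_nth_Suc[symmetric])
  qed
qed

lemma partial_eis_holomorphic: "partial_eis k holomorphic_on eis_dom"
proof -
  have "(\<lambda>\<tau>. fact k / (2 * pi * \<i>) ^ k * fps_nth (eis_fps \<tau>) k) holomorphic_on eis_dom"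
    by (intro holomorphic_intros eis_fps_nth_holomorphic)
  then show ?thesis by (simp add: eis_fps_def egf_nth)
qed

section \<open>The formulas for D(g_k) and D(Log T_0)\<close>

text \<open>Differentiating T' = -T G' once more leaves a factor T', for which the same identity is
  substituted.\<close>

lemma fps_deriv2_theta_fps:
  assumes "\<tau> \<in> eis_dom"
  shows "fps_deriv (fps_deriv (theta_fps \<tau>)) =
    theta_fps \<tau> * ((fps_deriv (eis_fps \<tau>))\<^sup>2 - fps_deriv (fps_deriv (eis_fps \<tau>)))"
proof -
  have "fps_deriv (fps_deriv (theta_fps \<tau>)) = fps_deriv (- (theta_fps \<tau> * fps_deriv (eis_fps \<tau>)))"
    by (simp only: fps_deriv_theta_fps[OF assms])
  also have "\<dots> = - (fps_deriv (theta_fps \<tau>) * fps_deriv (eis_fps \<tau>) +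
      theta_fps \<tau> * fps_deriv (fps_deriv (eis_fps \<tau>)))"
    by (simp add: algebra_simps)
  finally show ?thesis
    unfolding fps_deriv_theta_fps[OF assms] by (simp add: algebra_simps power2_eq_square)
qed

text \<open>Differentiating \<open>T' = - T G'\<close> in \<open>\<tau>\<close> and inserting the heat equation in the form
  \<open>\<partial>T/\<partial>\<tau> = T H\<close> leaves \<open>(\<partial>G/\<partial>\<tau>)' = - H'\<close>.\<close>

lemma fps_deriv_eis_fps_tau:
  assumes \<tau>: "\<tau> \<in> eis_dom" and E: "fps_has_deriv eis_fps E \<tau>"
  defines "H \<equiv> fps_const (1 / (4 * pi * \<i>)) *
    ((fps_deriv (eis_fps \<tau>))\<^sup>2 - fps_deriv (fps_deriv (eis_fps \<tau>)))"
  shows "fps_deriv E = - fps_deriv H"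
proof -
  let ?A = "theta_fps \<tau>" and ?G = "eis_fps \<tau>"
  have im: "Im \<tau> > 0" and nz: "?A \<noteq> 0"
    using \<tau> theta_fps_nth_0[of \<tau>] by (auto simp: eis_dom_def)
  have A: "fps_has_deriv theta_fps (?A * H) \<tau>"
    using theta_fps_has_deriv[OF im] by (simp add: fps_deriv2_theta_fps[OF \<tau>] H_def mult_ac)
  have "fps_has_deriv (\<lambda>t. - (theta_fps t * fps_deriv (eis_fps t)))
      (- (?A * H * fps_deriv ?G + ?A * fps_deriv E)) \<tau>"
    by (intro fps_has_deriv_uminus fps_has_deriv_mult fps_has_deriv_fps_deriv A E)
  then have "fps_has_deriv (\<lambda>t. fps_deriv (theta_fps t))
      (- (?A * H * fps_deriv ?G + ?A * fps_deriv E)) \<tau>"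
    by (rule fps_has_deriv_transform[OF _ open_eis_dom \<tau>]) (simp add: fps_deriv_theta_fps)
  \<comment> \<open>Two computations of the mixed derivative of T are equated; the terms containing
    the product T G' H then cancel.\<close>
  from fps_has_deriv_unique[OF fps_has_deriv_fps_deriv[OF A] this]
  have "?A * fps_deriv H - ?A * fps_deriv ?G * H = - (?A * H * fps_deriv ?G + ?A * fps_deriv E)"
    by (simp add: fps_deriv_theta_fps[OF \<tau>] algebra_simps)
  then have "?A * fps_deriv E = ?A * (- fps_deriv H)"
    by (simp add: algebra_simps)
  \<comment> \<open>Formal power series over the complex numbers have no zero divisors, so T can be
    cancelled.\<close>
  with nz show ?thesis using mult_cancel_left by blast
qed

lemma fps_nth_deriv2_eis_fps:
  "fps_nth (fps_deriv (fps_deriv (eis_fps \<tau>))) k =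
    (2 * pi * \<i>)\<^sup>2 * ((2 * pi * \<i>) ^ k / fact k * partial_eis (k + 2) \<tau>)"
  by (simp add: eis_fps_def fps_deriv_egf egf_nth power2_eq_square)

lemma fps_nth_deriv_eis_fps_square:
  "fps_nth ((fps_deriv (eis_fps \<tau>))\<^sup>2) k =
    (2 * pi * \<i>)\<^sup>2 * ((2 * pi * \<i>) ^ k / fact k *
      (\<Sum>d=0..k. of_nat (k choose d) * partial_eis (d + 1) \<tau> * partial_eis (k - d + 1) \<tau>))"
  by (simp add: eis_fps_def fps_deriv_egf egf_mult egf_nth power2_eq_square sum_distrib_left mult_ac)

lemma Dq_partial_eis:
  assumes k: "k \<ge> 1" and \<tau>: "\<tau> \<in> eis_dom"
  shows "Dq (partial_eis k) \<tau> = partial_eis (k + 2) \<tau> / 2 -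
    1/2 * (\<Sum>d=0..k. of_nat (k choose d) * partial_eis (d + 1) \<tau> * partial_eis (k - d + 1) \<tau>)"
    (is "_ = ?P / 2 - 1/2 * ?S")
proof -
  let ?u = "(2 * pi * \<i>) ^ k / fact k"
  \<comment> \<open>The coefficientwise \<tau>-derivative of G, available since every
    \<open>partial_eis n\<close> is holomorphic.\<close>
  define E where "E = Abs_fps (\<lambda>n. (2 * pi * \<i>) ^ n / fact n * deriv (partial_eis n) \<tau>)"
  have E: "fps_has_deriv eis_fps E \<tau>"
    unfolding fps_has_deriv_def
  proof
    fix n
    have "((\<lambda>t. (2 * pi * \<i>) ^ n / fact n * partial_eis n t) has_field_derivative
        (2 * pi * \<i>) ^ n / fact n * deriv (partial_eis n) \<tau>) (at \<tau>)"
      by (intro DERIV_cmult holomorphic_derivI[OF partial_eis_holomorphic open_eis_dom \<tau>])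
    then show "((\<lambda>t. fps_nth (eis_fps t) n) has_field_derivative fps_nth E n) (at \<tau>)"
      by (simp add: eis_fps_def egf_nth E_def)
  qed
  define H where "H = fps_const (1 / (4 * pi * \<i>)) *
    ((fps_deriv (eis_fps \<tau>))\<^sup>2 - fps_deriv (fps_deriv (eis_fps \<tau>)))"
  \<comment> \<open>The identity relates z-derivatives, so its coefficient at k - 1 compares those
    of \<open>E\<close> and \<open>H\<close> at k. Here k \<ge> 1 is essential.\<close>
  obtain m where m: "k = Suc m" using k by (cases k) auto
  have "fps_nth (fps_deriv E) m = fps_nth (- fps_deriv H) m"
    using fps_deriv_eis_fps_tau[OF \<tau> E] by (simp add: H_def)
  then have "of_nat (Suc m) * fps_nth E k = of_nat (Suc m) * (- fps_nth H k)"
    by (simp add: m del: of_nat_Suc)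
  then have "fps_nth E k = - fps_nth H k"
    by (simp only: mult_cancel_left of_nat_eq_0_iff) simp
  also have "fps_nth H k = 1 / (4 * pi * \<i>) * ((2 * pi * \<i>)\<^sup>2 * (?u * ?S) - (2 * pi * \<i>)\<^sup>2 * (?u * ?P))"
    unfolding H_def fps_mult_left_const_nth fps_sub_nth fps_nth_deriv_eis_fps_square
      fps_nth_deriv2_eis_fps ..
  \<comment> \<open>The halves arise from (2 pi i)^2 / (4 pi i) = (2 pi i) / 2.\<close>
  also have "- \<dots> = ?u * (2 * pi * \<i> * (?P / 2 - 1/2 * ?S))"
    by (simp add: field_simps power2_eq_square)
  finally have "?u * deriv (partial_eis k) \<tau> = ?u * (2 * pi * \<i> * (?P / 2 - 1/2 * ?S))"
    by (simp only: E_def fps_nth_Abs_fps)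
  then have "deriv (partial_eis k) \<tau> = 2 * pi * \<i> * (?P / 2 - 1/2 * ?S)"
    by (simp only: mult_cancel_left) simp
  then show ?thesis by (simp add: Dq_def)
qed

text \<open>This is the constant coefficient of the heat equation, evaluated with T'' = T (G'^2 -
  G'').\<close>

lemma Dq_partial_theta0:
  assumes "\<tau> \<in> eis_dom"
  shows "Dq partial_theta0 \<tau> / partial_theta0 \<tau> = - partial_eis 2 \<tau> / 2 + (partial_eis 1 \<tau>)\<^sup>2 / 2"
proof -
  have im: "Im \<tau> > 0" and nz: "partial_theta0 \<tau> \<noteq> 0" using assms by (auto simp: eis_dom_def)
  have "fps_nth (fps_deriv (fps_deriv (theta_fps \<tau>))) 0 =
      partial_theta0 \<tau> * ((2 * pi * \<i>)\<^sup>2 * ((partial_eis 1 \<tau>)\<^sup>2 - partial_eis 2 \<tau>))"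
    unfolding fps_deriv2_theta_fps[OF assms] fps_mult_nth_0 fps_sub_nth theta_fps_nth_0
      fps_nth_deriv_eis_fps_square fps_nth_deriv2_eis_fps
    by (simp add: power2_eq_square right_diff_distrib numeral_2_eq_2)
  moreover have "((\<lambda>t. fps_nth (theta_fps t) 0) has_field_derivative
      1 / (4 * pi * \<i>) * fps_nth (fps_deriv (fps_deriv (theta_fps \<tau>))) 0) (at \<tau>)"
    using theta_fps_has_deriv[OF im] unfolding fps_has_deriv_def fps_mult_left_const_nth by blast
  ultimately have "deriv partial_theta0 \<tau> =
      1 / (4 * pi * \<i>) * (partial_theta0 \<tau> * ((2 * pi * \<i>)\<^sup>2 * ((partial_eis 1 \<tau>)\<^sup>2 - partial_eis 2 \<tau>)))"
    unfolding theta_fps_nth_0 by (simp only: DERIV_imp_deriv)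
  also have "1 / (4 * pi * \<i>) * (partial_theta0 \<tau> * ((2 * pi * \<i>)\<^sup>2 * x)) =
      2 * pi * \<i> * (partial_theta0 \<tau> * (x / 2))" for x
    by (simp add: field_simps power2_eq_square)
  finally show ?thesis
    using nz by (simp add: Dq_def diff_divide_distrib)
qed

section \<open>Closure of the algebra under D\<close>

lemma eis_algebra_sum:
  assumes "finite I" "\<And>i. i \<in> I \<Longrightarrow> restrict (f i) eis_dom \<in> eis_algebra"
  shows "restrict (\<lambda>\<tau>. \<Sum>i\<in>I. f i \<tau>) eis_dom \<in> eis_algebra"
  using assms
proof (induction I)
  case empty
  then show ?case using eis_algebra.const[of 0] by (simp only: sum.empty)
next
  case (insert i I)
  then have "restrict (\<lambda>\<tau>. restrict (f i) eis_dom \<tau> + restrict (\<lambda>\<tau>. \<Sum>i\<in>I. f i \<tau>) eis_dom \<tau>) eis_dom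
      \<in> eis_algebra"
    by (intro eis_algebra.add) auto
  also have "restrict (\<lambda>\<tau>. restrict (f i) eis_dom \<tau> + restrict (\<lambda>\<tau>. \<Sum>i\<in>I. f i \<tau>) eis_dom \<tau>) eis_dom
      = restrict (\<lambda>\<tau>. \<Sum>i\<in>insert i I. f i \<tau>) eis_dom"
    using insert.hyps by (intro restrict_ext) simp
  finally show ?case .
qed

text \<open>Only the restrictions of \<open>f\<close> and \<open>h\<close> need to lie in the
  algebra, so formulas can be assembled without nested \<open>restrict\<close>.\<close>

lemma eis_algebra_mult:
  assumes "restrict f eis_dom \<in> eis_algebra" "restrict h eis_dom \<in> eis_algebra"
  shows "restrict (\<lambda>\<tau>. f \<tau> * h \<tau>) eis_dom \<in> eis_algebra"
  using eis_algebra.mult[OF assms] by (simp cong: restrict_cong)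

lemma eis_algebra_add:
  assumes "restrict f eis_dom \<in> eis_algebra" "restrict h eis_dom \<in> eis_algebra"
  shows "restrict (\<lambda>\<tau>. f \<tau> + h \<tau>) eis_dom \<in> eis_algebra"
  using eis_algebra.add[OF assms] by (simp cong: restrict_cong)

text \<open>The right-hand side of \<open>Dq_partial_eis\<close> is a polynomial in generators,
  since all indices in it are at least 1.\<close>

lemma eis_algebra_Dq_partial_eis:
  assumes "k \<ge> 1"
  shows "restrict (Dq (partial_eis k)) eis_dom \<in> eis_algebra"
proof -
  have "restrict (\<lambda>\<tau>. 1/2 * partial_eis (k + 2) \<tau> + (- 1/2) *
      (\<Sum>d=0..k. of_nat (k choose d) * partial_eis (d + 1) \<tau> * partial_eis (k - d + 1) \<tau>)) eis_dom
      \<in> eis_algebra"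
    by (intro eis_algebra_add eis_algebra_mult eis_algebra_sum eis_algebra.const eis_algebra.gen) auto
  then show ?thesis
    using Dq_partial_eis[OF assms] by (simp cong: restrict_cong)
qed

text \<open>The derivative is local and \<open>eis_dom\<close> is open, so the values outside do not
  matter.\<close>

lemma Dq_restrict:
  assumes "\<tau> \<in> eis_dom"
  shows "Dq (restrict f eis_dom) \<tau> = Dq f \<tau>"
proof -
  have "\<forall>\<^sub>F t in nhds \<tau>. t \<in> eis_dom"
    by (rule eventually_nhds_in_open[OF open_eis_dom assms])
  then have "\<forall>\<^sub>F t in nhds \<tau>. restrict f eis_dom t = f t"
    by eventually_elim simp
  then show ?thesis
    unfolding Dq_def by (simp add: deriv_cong_ev)
qed

lemma restrict_Dq_restrict: "restrict (Dq (restrict f eis_dom)) eis_dom = restrict (Dq f) eis_dom"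
  by (intro restrict_ext Dq_restrict)

lemma holomorphic_on_restrict: "f holomorphic_on A \<Longrightarrow> restrict f A holomorphic_on A"
  by (rule holomorphic_transform) auto

text \<open>D is a derivation, so closure on the generators propagates by induction. Holomorphy is
  carried along because the sum and product rules for \<open>deriv\<close> require
  differentiability.\<close>

lemma eis_algebra_Dq_closed:
  assumes "f \<in> eis_algebra"
  shows "f holomorphic_on eis_dom \<and> restrict (Dq f) eis_dom \<in> eis_algebra"
  using assms
proof induction
  case (const c)
  have "restrict (Dq (restrict (\<lambda>_. c) eis_dom)) eis_dom = restrict (\<lambda>_. 0) eis_dom"
    unfolding restrict_Dq_restrict by (intro restrict_ext) (simp add: Dq_def)
  then show ?case
    by (simp only: eis_algebra.const holomorphic_on_restrict[OF holomorphic_on_const] simp_thms)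
next
  case (gen k)
  then show ?case
    unfolding restrict_Dq_restrict
    by (intro conjI holomorphic_on_restrict partial_eis_holomorphic eis_algebra_Dq_partial_eis)
next
  case (add f h)
  then have hol: "f holomorphic_on eis_dom" "h holomorphic_on eis_dom" by auto
  have eq: "Dq (\<lambda>\<tau>. f \<tau> + h \<tau>) \<tau> = Dq f \<tau> + Dq h \<tau>" if "\<tau> \<in> eis_dom" for \<tau>
    using holomorphic_on_imp_differentiable_at[OF _ open_eis_dom that] hol
    by (simp add: Dq_def add_divide_distrib)
  have "restrict (\<lambda>\<tau>. Dq f \<tau> + Dq h \<tau>) eis_dom \<in> eis_algebra"
    using add.IH by (intro eis_algebra_add) blast+
  then have "restrict (Dq (\<lambda>\<tau>. f \<tau> + h \<tau>)) eis_dom \<in> eis_algebra"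
    by (simp add: eq cong: restrict_cong)
  then show ?case
    unfolding restrict_Dq_restrict by (intro conjI holomorphic_on_restrict holomorphic_intros hol)
next
  case (mult f h)
  then have hol: "f holomorphic_on eis_dom" "h holomorphic_on eis_dom" by auto
  have eq: "Dq (\<lambda>\<tau>. f \<tau> * h \<tau>) \<tau> = f \<tau> * Dq h \<tau> + Dq f \<tau> * h \<tau>" if "\<tau> \<in> eis_dom" for \<tau>
    using holomorphic_on_imp_differentiable_at[OF _ open_eis_dom that] hol
    by (simp add: Dq_def add_divide_distrib)
  \<comment> \<open>The product rule also contains undifferentiated factors. Members of the algebra
    are already extensional, so restricting them again changes nothing.\<close>
  have ext: "restrict f eis_dom \<in> eis_algebra" if "f \<in> eis_algebra" for f
    using that by cases (simp_all only: restrict_restrict Int_absorb, (blast intro: eis_algebra.intros)+)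
  have "restrict (\<lambda>\<tau>. f \<tau> * Dq h \<tau> + Dq f \<tau> * h \<tau>) eis_dom \<in> eis_algebra"
    using mult.IH mult.hyps ext by (intro eis_algebra_add eis_algebra_mult) blast+
  then have "restrict (Dq (\<lambda>\<tau>. f \<tau> * h \<tau>)) eis_dom \<in> eis_algebra"
    by (simp add: eq cong: restrict_cong)
  then show ?case
    unfolding restrict_Dq_restrict by (intro conjI holomorphic_on_restrict holomorphic_intros hol)
qed

theorem theorem1p3:
  shows "(\<forall>f\<in>eis_algebra. f holomorphic_on eis_dom \<and> restrict (Dq f) eis_dom \<in> eis_algebra) \<and>
    (\<forall>k\<ge>1. \<forall>\<tau>\<in>eis_dom.
       Dq (partial_eis k) \<tau> =
         partial_eis (k + 2) \<tau> / 2 -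
         1/2 * (\<Sum>d=0..k. of_nat (k choose d) * partial_eis (d + 1) \<tau> * partial_eis (k - d + 1) \<tau>)) \<and>
    (\<forall>\<tau>\<in>eis_dom.
       Dq partial_theta0 \<tau> / partial_theta0 \<tau> =
         - partial_eis 2 \<tau> / 2 + (partial_eis 1 \<tau>)\<^sup>2 / 2)"
  using eis_algebra_Dq_closed Dq_partial_eis Dq_partial_theta0 by blast

end
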